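(* Let $\mathcal{E}=\mathcal{E}_0\oplus\mathcal{E}_1$ and $\mathcal{E}'=\mathcal{E}_0'\oplus\mathcal{E}_1'$ be orthogonal decompositions of complex Hilbert spaces (not necessarily separable), and let $T,T'$ be contractions from $\mathcal{E}$ to $\mathcal{E}'$ with block matrices $$T=\begin{pmatrix} T_0 & T_1 \\ T_2 & T_3 \end{pmatrix},\qquad T'=\begin{pmatrix} T_0' & T_1' \\ T_2' & T_3' \end{pmatrix}$$ with respect to these decompositions, satisfying $$T_0^*T_1+T_2^*T_3=T_0'^*T_1'+T_2'^*T_3'=0,\quad T_0^*T_1'+T_2^*T_3'=0,\quad T_1^*T_0'+T_3^*T_2'=0.$$ Let $C_0=\begin{pmatrix} T_0 \\ T_2 \end{pmatrix}$, $C_0'=\begin{pmatrix} T_0' \\ T_2' \end{pmatrix}:\mathcal{E}_0\to\mathcal{E}_0'\oplus\mathcal{E}_1'$ and $C_1=\begin{pmatrix} T_1 \\ T_3 \end{pmatrix}$, $C_1'=\begin{pmatrix} T_1' \\ T_3' \end{pmatrix}:\mathcal{E}_1\to\mathcal{E}_0'\oplus\mathcal{E}_1'$ be the column operators. If $C_0$ and $C_0'$ are Shmul'yan equivalent and $C_1$ and $C_1'$ are Shmul'yan equivalent, then $T$ and $T'$ are Shmul'yan equivalent.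
   Context: A contraction is a bounded linear operator of norm at most $1$. For a contraction $A$ between Hilbert spaces, $D_A=(I-A^*A)^{1/2}$ and $\mathcal{D}_A=\overline{\mathcal{R}(D_A)}$. For contractions $A,B\in\mathcal{B}(\mathcal{H}_1,\mathcal{H}_2)$, $A$ Shmul'yan dominates $B$ if $B=A+D_{A^*}XD_A$ for some bounded $X\in\mathcal{B}(\mathcal{D}_A,\mathcal{D}_{A^*})$; $A$ and $B$ are Shmul'yan equivalent if each Shmul'yan dominates the other. *)

theory Defs
  imports "HOL-Analysis.Analysis"
begin

text \<open>
  The inner product is linear in the first argument. The norm, the topology and the underlying
  real structure are those of class \<^class>\<open>real_inner\<close>, tied to the complex structure by
  \<open>scaleR_scaleC\<close> and \<open>inner_eq_Re_cinner\<close>; hence the norm of \<open>x\<close> is the square root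
  of \<open>cinner x x\<close>.
\<close>

class complex_inner = real_inner +
  fixes scaleC :: "complex \<Rightarrow> 'a \<Rightarrow> 'a" (infixr \<open>*\<^sub>C\<close> 75)
    and cinner :: "'a \<Rightarrow> 'a \<Rightarrow> complex"
  assumes scaleC_add_right: "c *\<^sub>C (x + y) = c *\<^sub>C x + c *\<^sub>C y"
    and scaleC_add_left: "(c + d) *\<^sub>C x = c *\<^sub>C x + d *\<^sub>C x"
    and scaleC_scaleC: "c *\<^sub>C (d *\<^sub>C x) = (c * d) *\<^sub>C x"
    and scaleC_one: "1 *\<^sub>C x = x"
    and scaleR_scaleC: "r *\<^sub>R x = complex_of_real r *\<^sub>C x"
    and cinner_commute: "cinner x y = cnj (cinner y x)"
    and cinner_add_left: "cinner (x + y) z = cinner x z + cinner y z"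
    and cinner_scaleC_left: "cinner (c *\<^sub>C x) y = c * cinner x y"
    and inner_eq_Re_cinner: "x \<bullet> y = Re (cinner x y)"

class chilbert_space = complex_inner + complete_space

text \<open>The product type is the orthogonal direct sum.\<close>

instantiation prod :: (complex_inner, complex_inner) complex_inner
begin

definition scaleC_prod :: "complex \<Rightarrow> 'a \<times> 'b \<Rightarrow> 'a \<times> 'b"
  where "scaleC_prod c x = (c *\<^sub>C fst x, c *\<^sub>C snd x)"

definition cinner_prod :: "'a \<times> 'b \<Rightarrow> 'a \<times> 'b \<Rightarrow> complex"
  where "cinner_prod x y = cinner (fst x) (fst y) + cinner (snd x) (snd y)"

instance
proof
  fix x y z :: "'a \<times> 'b" and c d :: complex and r :: real
  show "c *\<^sub>C (x + y) = c *\<^sub>C x + c *\<^sub>C y"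
    by (simp add: scaleC_prod_def scaleC_add_right)
  show "(c + d) *\<^sub>C x = c *\<^sub>C x + d *\<^sub>C x"
    by (simp add: scaleC_prod_def scaleC_add_left)
  show "c *\<^sub>C (d *\<^sub>C x) = (c * d) *\<^sub>C x"
    by (simp add: scaleC_prod_def scaleC_scaleC)
  show "1 *\<^sub>C x = x"
    by (simp add: scaleC_prod_def scaleC_one)
  show "r *\<^sub>R x = complex_of_real r *\<^sub>C x"
    by (simp add: scaleC_prod_def scaleR_prod_def scaleR_scaleC)
  show "cinner x y = cnj (cinner y x)"
    unfolding cinner_prod_def complex_cnj_add by (metis cinner_commute)
  show "cinner (x + y) z = cinner x z + cinner y z"
    by (simp add: cinner_prod_def cinner_add_left)
  show "cinner (c *\<^sub>C x) y = c * cinner x y"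
    by (simp add: cinner_prod_def scaleC_prod_def cinner_scaleC_left algebra_simps)
  show "x \<bullet> y = Re (cinner x y)"
    by (simp add: cinner_prod_def inner_prod_def inner_eq_Re_cinner)
qed

end

instance prod :: (chilbert_space, chilbert_space) chilbert_space ..

text \<open>
  \<open>bounded_clinear_between H K A\<close>: the restriction of \<open>A\<close> to the subspace \<open>H\<close> is a bounded
  complex-linear operator from \<open>H\<close> to \<open>K\<close>; the values of \<open>A\<close> outside \<open>H\<close> are irrelevant.
\<close>

definition bounded_clinear_between ::
    "'a::complex_inner set \<Rightarrow> 'b::complex_inner set \<Rightarrow> ('a \<Rightarrow> 'b) \<Rightarrow> bool"
  where "bounded_clinear_between H K A \<longleftrightarrow>
    A ` H \<subseteq> K \<and>
    (\<forall>x\<in>H. \<forall>y\<in>H. A (x + y) = A x + A y) \<and>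
    (\<forall>c. \<forall>x\<in>H. A (c *\<^sub>C x) = c *\<^sub>C A x) \<and>
    (\<exists>M. \<forall>x\<in>H. norm (A x) \<le> M * norm x)"

abbreviation bounded_clinear :: "('a::complex_inner \<Rightarrow> 'b::complex_inner) \<Rightarrow> bool"
  where "bounded_clinear \<equiv> bounded_clinear_between UNIV UNIV"

definition contraction :: "('a::complex_inner \<Rightarrow> 'b::complex_inner) \<Rightarrow> bool"
  where "contraction A \<longleftrightarrow> bounded_clinear A \<and> onorm A \<le> 1"

definition cadjoint :: "('a::complex_inner \<Rightarrow> 'b::complex_inner) \<Rightarrow> 'b \<Rightarrow> 'a"
  where "cadjoint A = (THE B. \<forall>x y. cinner (A x) y = cinner x (B y))"

definition positive_op :: "('a::complex_inner \<Rightarrow> 'a) \<Rightarrow> bool"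
  where "positive_op S \<longleftrightarrow> bounded_clinear S \<and> (\<forall>x. cinner (S x) x \<in> \<real>\<^sub>\<ge>\<^sub>0)"

definition sqrt_op :: "('a::complex_inner \<Rightarrow> 'a) \<Rightarrow> 'a \<Rightarrow> 'a"
  where "sqrt_op P = (THE S. positive_op S \<and> S \<circ> S = P)"

definition defect :: "('a::complex_inner \<Rightarrow> 'b::complex_inner) \<Rightarrow> 'a \<Rightarrow> 'a"
  where "defect A = sqrt_op (\<lambda>x. x - cadjoint A (A x))"

definition defect_space :: "('a::complex_inner \<Rightarrow> 'b::complex_inner) \<Rightarrow> 'a set"
  where "defect_space A = closure (range (defect A))"

definition shmulyan_dominates ::
    "('a::complex_inner \<Rightarrow> 'b::complex_inner) \<Rightarrow> ('a \<Rightarrow> 'b) \<Rightarrow> bool"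
  where "shmulyan_dominates A B \<longleftrightarrow>
    contraction A \<and> contraction B \<and>
    (\<exists>X. bounded_clinear_between (defect_space A) (defect_space (cadjoint A)) X \<and>
         (\<forall>x. B x = A x + defect (cadjoint A) (X (defect A x))))"

definition shmulyan_equivalent ::
    "('a::complex_inner \<Rightarrow> 'b::complex_inner) \<Rightarrow> ('a \<Rightarrow> 'b) \<Rightarrow> bool"
  where "shmulyan_equivalent A B \<longleftrightarrow> shmulyan_dominates A B \<and> shmulyan_dominates B A"

text \<open>\<open>block_op T0 T1 T2 T3\<close> has first row \<open>T0 T1\<close> and second row \<open>T2 T3\<close>.\<close>

definition block_op ::
    "('a \<Rightarrow> 'c) \<Rightarrow> ('b \<Rightarrow> 'c) \<Rightarrow> ('a \<Rightarrow> 'd) \<Rightarrow> ('b \<Rightarrow> 'd) \<Rightarrow>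
     'a \<times> 'b \<Rightarrow> 'c::complex_inner \<times> 'd::complex_inner"
  where "block_op T0 T1 T2 T3 = (\<lambda>(x, y). (T0 x + T1 y, T2 x + T3 y))"

definition column_op :: "('a \<Rightarrow> 'c) \<Rightarrow> ('a \<Rightarrow> 'd) \<Rightarrow> 'a \<Rightarrow> 'c \<times> 'd"
  where "column_op A B = (\<lambda>x. (A x, B x))"

end

theory Submission
  imports Defs
begin

text \<open>
  If \<open>A\<^sup>*A Z = Z B\<^sup>*B\<close> for a bounded \<open>Z\<close>, then \<open>D\<^sub>A Z = Z D\<^sub>B\<close>, because the square root is a limit of
  polynomials. Write \<open>T\<close> as the row of its columns \<open>C\<^sub>0\<close> and \<open>C\<^sub>1\<close>, whose ranges are orthogonal. With \<open>Z\<close>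
  the two embeddings into the direct sum, \<open>D\<^sub>T\<close> is the direct sum of the defect operators of \<open>C\<^sub>0\<close> and \<open>C\<^sub>1\<close>. With
  \<open>Z\<close> the projection \<open>Q\<^sub>1\<close> onto the kernel of \<open>C\<^sub>1\<^sup>*\<close>, the defect operator of \<open>T\<^sup>*\<close> composed with \<open>Q\<^sub>1\<close>
  equals \<open>Q\<^sub>1\<close> composed with that of \<open>C\<^sub>0\<^sup>*\<close>; symmetrically for the projection \<open>Q\<^sub>0\<close> onto the kernel of
  \<open>C\<^sub>0\<^sup>*\<close>. The cross conditions place the ranges of \<open>C\<^sub>0' - C\<^sub>0\<close> and \<open>C\<^sub>1' - C\<^sub>1\<close> in these kernels, so if
  \<open>X\<^sub>0\<close> and \<open>X\<^sub>1\<close> witness domination of the columns, the row of \<open>Q\<^sub>1 X\<^sub>0\<close> and \<open>Q\<^sub>0 X\<^sub>1\<close> witnesses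
  domination of \<open>T'\<close> by \<open>T\<close>.
\<close>

section \<open>Orthogonal projections and adjoints\<close>

text \<open>A minimising sequence for the distance to \<open>M\<close> is Cauchy by the
  parallelogram law, and optimality of its limit along each line in \<open>M\<close> gives
  orthogonality.\<close>

lemma closed_subspace_orthogonal_projection:
  fixes M :: "'a::{real_inner,complete_space} set"
  assumes M: "subspace M" "closed M"
  shows "\<exists>q\<in>M. \<forall>m\<in>M. (x - q) \<bullet> m = 0"
proof -
  have ne: "M \<noteq> {}" using M(1) subspace_0 by blast
  define d where "d = infdist x M"
  have d0: "d \<ge> 0" unfolding d_def by (rule infdist_nonneg)
  have dle: "d \<le> norm (x - m)" if "m \<in> M" for m
    unfolding d_def using infdist_le[OF that, of x] by (simp add: dist_norm)
  have "\<exists>m\<in>M. norm (x - m) < d + 1 / real (Suc n)" for n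
  proof -
    have "infdist x M < d + 1 / real (Suc n)" by (simp add: d_def)
    then show ?thesis
      unfolding infdist_notempty[OF ne] using cINF_less_iff[OF ne bdd_below_image_dist, of x]
      by (simp add: dist_norm)
  qed
  then obtain f where fM: "\<And>n. f n \<in> M" and f: "\<And>n. norm (x - f n) < d + 1 / real (Suc n)"
    by metis
  have lim_f: "(\<lambda>n. norm (x - f n)) \<longlonglongrightarrow> d"
  proof (rule tendsto_sandwich)
    show "eventually (\<lambda>n. d \<le> norm (x - f n)) sequentially" using dle fM by simp
    show "eventually (\<lambda>n. norm (x - f n) \<le> d + 1 / real (Suc n)) sequentially"
      using f by (simp add: less_imp_le)
    show "(\<lambda>n. d + 1 / real (Suc n)) \<longlonglongrightarrow> d"
      using tendsto_add[OF tendsto_const[of d] LIMSEQ_Suc[OF lim_1_over_n[where 'a=real]]] by simp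
  qed simp
  \<comment> \<open>Midpoints stay in \<open>M\<close>, hence at distance at least \<open>d\<close>
    from \<open>x\<close>; the parallelogram law turns this into closeness of \<open>f m\<close> and
    \<open>f n\<close>.\<close>
  have par: "(norm (f m - f n))\<^sup>2 \<le> 2 * (norm (x - f m))\<^sup>2 + 2 * (norm (x - f n))\<^sup>2 - 4 * d\<^sup>2" for m n
  proof -
    let ?h = "(1/2) *\<^sub>R (f m + f n)"
    have "?h \<in> M" using M(1) fM by (simp add: subspace_add subspace_scale)
    then have "d\<^sup>2 \<le> (norm (x - ?h))\<^sup>2" using dle d0 by (simp add: power_mono)
    moreover have "(norm (f m - f n))\<^sup>2 + 4 * (norm (x - ?h))\<^sup>2
        = 2 * (norm (x - f m))\<^sup>2 + 2 * (norm (x - f n))\<^sup>2"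
      unfolding power2_norm_eq_inner
      by (simp add: inner_diff_left inner_diff_right inner_add_left inner_add_right inner_commute
          algebra_simps)
    ultimately show ?thesis by linarith
  qed
  have "Cauchy f"
  proof (rule metric_CauchyI)
    fix e :: real assume e: "0 < e"
    have "(\<lambda>n. (norm (x - f n))\<^sup>2) \<longlonglongrightarrow> d\<^sup>2" by (rule tendsto_power[OF lim_f])
    moreover have "d\<^sup>2 < d\<^sup>2 + e\<^sup>2 / 4" using e by simp
    ultimately have "eventually (\<lambda>n. (norm (x - f n))\<^sup>2 < d\<^sup>2 + e\<^sup>2 / 4) sequentially"
      by (rule order_tendstoD(2))
    then obtain N where N: "\<And>n. n \<ge> N \<Longrightarrow> (norm (x - f n))\<^sup>2 < d\<^sup>2 + e\<^sup>2 / 4"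
      unfolding eventually_sequentially by blast
    have "dist (f m) (f n) < e" if "m \<ge> N" "n \<ge> N" for m n
    proof -
      have "(norm (f m - f n))\<^sup>2 < e\<^sup>2" using par[of m n] N[OF that(1)] N[OF that(2)] by linarith
      then show ?thesis using e by (simp add: dist_norm power2_less_imp_less)
    qed
    then show "\<exists>N. \<forall>m\<ge>N. \<forall>n\<ge>N. dist (f m) (f n) < e" by blast
  qed
  then obtain q where q: "f \<longlonglongrightarrow> q" using Cauchy_convergent convergent_def by blast
  have qM: "q \<in> M" using closed_sequentially[OF M(2)] fM q by blast
  have "(\<lambda>n. norm (x - f n)) \<longlonglongrightarrow> norm (x - q)" by (intro tendsto_intros q)
  then have dq: "norm (x - q) = d" using lim_f LIMSEQ_unique by blast
  have "(x - q) \<bullet> m = 0" if "m \<in> M" for m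
  proof (cases "m = 0")
    case False
    \<comment> \<open>The minimiser of the distance to \<open>x\<close> on the line through
      \<open>q\<close> in direction \<open>m\<close>; moving there would lower the squared distance
      by \<open>((x - q) \<bullet> m)\<^sup>2 / (m \<bullet> m)\<close>.\<close>
    let ?c = "((x - q) \<bullet> m) / (m \<bullet> m)"
    have mm: "m \<bullet> m > 0" using False by simp
    have "q + ?c *\<^sub>R m \<in> M" using M(1) qM that by (simp add: subspace_add subspace_scale)
    then have "d\<^sup>2 \<le> (norm (x - (q + ?c *\<^sub>R m)))\<^sup>2" using dle d0 by (simp add: power_mono)
    also have "x - (q + ?c *\<^sub>R m) = (x - q) - ?c *\<^sub>R m" by simp
    also have "(norm ((x - q) - ?c *\<^sub>R m))\<^sup>2 = (norm (x - q))\<^sup>2 - 2 * ?c * ((x - q) \<bullet> m) + ?c\<^sup>2 * (m \<bullet> m)"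
      unfolding power2_norm_eq_inner
      by (simp add: inner_diff_left[of "x - q"] inner_diff_right[of _ "x - q"] inner_commute[of m "x - q"]
          power2_eq_square)
    also have "\<dots> = d\<^sup>2 - ((x - q) \<bullet> m)\<^sup>2 / (m \<bullet> m)"
      using mm dq by (simp add: field_simps power2_eq_square)
    finally have "((x - q) \<bullet> m)\<^sup>2 / (m \<bullet> m) \<le> 0" by simp
    then show ?thesis using mm by (simp add: divide_le_0_iff)
  qed simp
  then show ?thesis using qM by blast
qed

text \<open>A nonzero \<open>w\<close> orthogonal to the kernel of \<open>f\<close> spans its
  complement, since \<open>x - (f x / f w) w\<close> always lies in the kernel. The real form is
  enough: \<open>cadjoint_eqI_real\<close> recovers the complex identity.\<close>

lemma riesz_representation:
  fixes f :: "'a::{real_inner,complete_space} \<Rightarrow> real"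
  assumes f: "bounded_linear f"
  shows "\<exists>z. \<forall>x. f x = x \<bullet> z"
proof (cases "\<forall>x. f x = 0")
  case True
  then show ?thesis by (intro exI[of _ 0]) simp
next
  case False
  then obtain x0 where x0: "f x0 \<noteq> 0" by blast
  interpret f: bounded_linear f by (rule f)
  have "subspace {x. f x = 0}" by (auto simp: subspace_def f.add f.scaleR)
  moreover have "closed {x. f x = 0}"
    by (intro closed_Collect_eq continuous_intros f.continuous_on)
  ultimately obtain q where q: "f q = 0" and orth: "\<And>m. f m = 0 \<Longrightarrow> (x0 - q) \<bullet> m = 0"
    using closed_subspace_orthogonal_projection[of "{x. f x = 0}" x0] by blast
  define w where "w = x0 - q"
  have fw: "f w = f x0" using q by (simp add: w_def f.diff)
  have ww: "w \<bullet> w \<noteq> 0" using fw x0 f.zero by auto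
  have "f x = x \<bullet> ((f w / (w \<bullet> w)) *\<^sub>R w)" for x
  proof -
    have "f (x - (f x / f w) *\<^sub>R w) = 0" using fw x0 by (simp add: f.diff f.scaleR)
    then have "w \<bullet> (x - (f x / f w) *\<^sub>R w) = 0" unfolding w_def by (rule orth)
    then show ?thesis using ww fw x0 by (simp add: inner_diff_right inner_commute field_simps)
  qed
  then show ?thesis by blast
qed

section \<open>Complex structure in terms of the real inner product\<close>

lemma bounded_clinear_iff:
  "bounded_clinear A \<longleftrightarrow> bounded_linear A \<and> (\<forall>c x. A (c *\<^sub>C x) = c *\<^sub>C A x)"
proof
  assume A: "bounded_clinear A"
  then obtain M where M: "\<And>x. norm (A x) \<le> M * norm x"
    unfolding bounded_clinear_between_def by auto
  have "bounded_linear A"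
    by (rule bounded_linear_intro[where K = M])
      (use A M in \<open>auto simp: bounded_clinear_between_def scaleR_scaleC mult.commute\<close>)
  then show "bounded_linear A \<and> (\<forall>c x. A (c *\<^sub>C x) = c *\<^sub>C A x)"
    using A by (simp add: bounded_clinear_between_def)
next
  assume A: "bounded_linear A \<and> (\<forall>c x. A (c *\<^sub>C x) = c *\<^sub>C A x)"
  then interpret bounded_linear A by blast
  show "bounded_clinear A"
    using A add bounded by (auto simp: bounded_clinear_between_def mult.commute)
qed

lemma scaleC_minus_one: "(-1) *\<^sub>C x = - (x::'a::complex_inner)"
  using scaleR_scaleC[of "-1" x] by simp

lemma scaleC_ii_ii: "\<i> *\<^sub>C (\<i> *\<^sub>C x) = - (x::'a::complex_inner)"
  by (simp add: scaleC_scaleC scaleC_minus_one)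

lemma scaleC_diff_right: "c *\<^sub>C (x - y) = c *\<^sub>C x - c *\<^sub>C (y::'a::complex_inner)"
  by (metis scaleC_add_right diff_add_cancel add_diff_cancel_right')

lemma scaleC_zero_right: "c *\<^sub>C (0::'a::complex_inner) = 0"
  using scaleC_diff_right[of c 0 0] by simp

lemma scaleC_scaleR_commute: "c *\<^sub>C (r *\<^sub>R x) = r *\<^sub>R (c *\<^sub>C (x::'a::complex_inner))"
  by (simp add: scaleR_scaleC scaleC_scaleC mult.commute)

text \<open>The imaginary part of a complex number c is -Re(i c), so complex identities reduce to
  real ones at \<open>x\<close> and at i times \<open>x\<close>.\<close>

lemma cinner_conv_inner: "cinner x y = Complex (x \<bullet> y) (- ((\<i> *\<^sub>C x) \<bullet> y))"
  by (simp add: inner_eq_Re_cinner cinner_scaleC_left complex_eq_iff)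

lemma cinner_scaleC_right: "cinner x (c *\<^sub>C y) = cnj c * cinner x y"
  by (metis cinner_commute cinner_scaleC_left complex_cnj_cnj complex_cnj_mult)

lemma inner_scaleC_left: "(c *\<^sub>C x) \<bullet> y = x \<bullet> (cnj c *\<^sub>C y)"
  by (simp add: inner_eq_Re_cinner cinner_scaleC_left cinner_scaleC_right)

lemma inner_scaleC_ii: "(\<i> *\<^sub>C x) \<bullet> (\<i> *\<^sub>C y) = x \<bullet> y"
  by (simp add: inner_scaleC_left scaleC_scaleC scaleC_one)

lemma norm_scaleC: "norm (c *\<^sub>C x) = cmod c * norm (x::'a::complex_inner)"
proof -
  have "(norm (c *\<^sub>C x))\<^sup>2 = x \<bullet> ((cnj c * c) *\<^sub>C x)"
    by (simp add: power2_norm_eq_inner inner_scaleC_left scaleC_scaleC)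
  also have "cnj c * c = complex_of_real ((cmod c)\<^sup>2)"
    by (metis complex_norm_square mult.commute of_real_power)
  finally have "(norm (c *\<^sub>C x))\<^sup>2 = (cmod c * norm x)\<^sup>2"
    by (simp flip: scaleR_scaleC add: power_mult_distrib power2_norm_eq_inner)
  then show ?thesis by (simp add: power2_eq_iff_nonneg)
qed

lemma bounded_linear_scaleC: "bounded_linear (\<lambda>x::'a::complex_inner. c *\<^sub>C x)"
  by (rule bounded_linear_intro[where K = "cmod c"])
    (simp_all add: scaleC_add_right scaleC_scaleR_commute norm_scaleC mult.commute)

lemma bounded_clinear_compose:
  "bounded_clinear A \<Longrightarrow> bounded_clinear B \<Longrightarrow> bounded_clinear (\<lambda>x. A (B x))"
  by (simp add: bounded_clinear_iff bounded_linear_compose)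

lemma bounded_clinear_diff:
  "bounded_clinear A \<Longrightarrow> bounded_clinear B \<Longrightarrow> bounded_clinear (\<lambda>x. A x - B x)"
  by (simp add: bounded_clinear_iff bounded_linear_sub scaleC_diff_right)

lemma bounded_clinear_ident: "bounded_clinear (\<lambda>x. x)"
  by (simp add: bounded_clinear_iff bounded_linear_ident)

section \<open>Adjoints of bounded operators\<close>

lemma cadjoint_eqI:
  assumes "\<And>x y. cinner (A x) y = cinner x (B y)"
  shows "cadjoint A = B"
  unfolding cadjoint_def
proof (rule the_equality)
  fix B' assume B': "\<forall>x y. cinner (A x) y = cinner x (B' y)"
  show "B' = B"
  proof
    fix y
    have "x \<bullet> B' y = x \<bullet> B y" for x using assms B' by (simp add: inner_eq_Re_cinner)
    then show "B' y = B y" by (metis vector_eq_ldot)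
  qed
qed (use assms in simp)

text \<open>Complex linearity of \<open>A\<close> lets the real identity be used at i times
  \<open>x\<close> as well, which supplies the imaginary part.\<close>

lemma cadjoint_eqI_real:
  assumes A: "bounded_clinear A" and B: "\<And>x y. A x \<bullet> y = x \<bullet> B y"
  shows "cadjoint A = B"
proof (rule cadjoint_eqI)
  fix x y
  have "A (\<i> *\<^sub>C x) = \<i> *\<^sub>C A x" using A by (simp add: bounded_clinear_iff)
  then show "cinner (A x) y = cinner x (B y)" by (metis B cinner_conv_inner)
qed

text \<open>\<open>cadjoint\<close> is a definite description, so existence must be shown: the Riesz
  vector of the functional sending \<open>x\<close> to \<open>A x \<bullet> y\<close> is the value
  of the adjoint at \<open>y\<close>.\<close>

lemma inner_cadjoint:
  fixes A :: "'a::chilbert_space \<Rightarrow> 'b::complex_inner"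
  assumes A: "bounded_clinear A"
  shows "A x \<bullet> y = x \<bullet> cadjoint A y"
proof -
  have "bounded_linear A" using A by (simp add: bounded_clinear_iff)
  then have "\<exists>z. \<forall>x. A x \<bullet> y = x \<bullet> z" for y
    by (intro riesz_representation bounded_linear_compose[OF bounded_linear_inner_left])
  then obtain B where "\<And>x y. A x \<bullet> y = x \<bullet> B y" by metis
  then show ?thesis using cadjoint_eqI_real[OF A] by metis
qed

lemma bounded_clinear_cadjoint:
  fixes A :: "'a::chilbert_space \<Rightarrow> 'b::complex_inner"
  assumes A: "bounded_clinear A"
  shows "bounded_clinear (cadjoint A)"
proof -
  have A': "bounded_linear A" and Ac: "\<And>c x. A (c *\<^sub>C x) = c *\<^sub>C A x"
    using A by (simp_all add: bounded_clinear_iff)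
  note adj = inner_cadjoint[OF A]
  obtain K where K: "K > 0" "\<And>x. norm (A x) \<le> norm x * K" using bounded_linear.pos_bounded[OF A'] by blast
  have "bounded_linear (cadjoint A)"
  proof (rule bounded_linear_intro[where K = K])
    fix x y r
    have "z \<bullet> cadjoint A (x + y) = z \<bullet> (cadjoint A x + cadjoint A y)" for z
      by (simp add: adj[symmetric] inner_add_right)
    then show "cadjoint A (x + y) = cadjoint A x + cadjoint A y" by (metis vector_eq_ldot)
    have "z \<bullet> cadjoint A (r *\<^sub>R x) = z \<bullet> (r *\<^sub>R cadjoint A x)" for z
      by (simp add: adj[symmetric])
    then show "cadjoint A (r *\<^sub>R x) = r *\<^sub>R cadjoint A x" by (metis vector_eq_ldot)
    \<comment> \<open>Pairing \<open>?w\<close> with itself moves one copy through \<open>A\<close>;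
      one factor \<open>norm ?w\<close> then cancels.\<close>
    let ?w = "cadjoint A x"
    have "norm ?w * norm ?w = A ?w \<bullet> x"
      by (simp add: adj power2_norm_eq_inner flip: power2_eq_square)
    also have "\<dots> \<le> norm (A ?w) * norm x" by (rule norm_cauchy_schwarz)
    also have "\<dots> \<le> (norm ?w * K) * norm x" by (intro mult_right_mono K) simp
    finally have "norm ?w * norm ?w \<le> norm ?w * (norm x * K)" by (simp add: algebra_simps)
    then show "norm ?w \<le> norm x * K"
      using K(1) by (cases "norm ?w = 0") (auto simp: mult_le_cancel_left)
  qed
  moreover have "cadjoint A (c *\<^sub>C x) = c *\<^sub>C cadjoint A x" for c x
  proof -
    have "z \<bullet> cadjoint A (c *\<^sub>C x) = z \<bullet> (c *\<^sub>C cadjoint A x)" for z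
      by (metis adj Ac inner_scaleC_left complex_cnj_cnj)
    then show ?thesis by (metis vector_eq_ldot)
  qed
  ultimately show ?thesis by (simp add: bounded_clinear_iff)
qed

lemma cadjoint_cadjoint:
  fixes A :: "'a::chilbert_space \<Rightarrow> 'b::complex_inner"
  assumes "bounded_clinear A"
  shows "cadjoint (cadjoint A) = A"
  by (rule cadjoint_eqI_real[OF bounded_clinear_cadjoint[OF assms]])
    (metis inner_cadjoint[OF assms] inner_commute)

lemma contractionD:
  assumes "contraction A"
  shows "bounded_clinear A" "norm (A x) \<le> norm x"
proof -
  show A: "bounded_clinear A" using assms by (simp add: contraction_def)
  then have "norm (A x) \<le> onorm A * norm x" by (simp add: bounded_clinear_iff onorm)
  also have "\<dots> \<le> 1 * norm x" using assms by (intro mult_right_mono) (simp_all add: contraction_def)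
  finally show "norm (A x) \<le> norm x" by simp
qed

lemma norm_cadjoint_le:
  fixes A :: "'a::chilbert_space \<Rightarrow> 'b::complex_inner"
  assumes A: "contraction A"
  shows "norm (cadjoint A y) \<le> norm y"
proof -
  let ?w = "cadjoint A y"
  have "norm ?w * norm ?w = A ?w \<bullet> y"
    by (simp add: inner_cadjoint[OF contractionD(1)[OF A]] power2_norm_eq_inner flip: power2_eq_square)
  also have "\<dots> \<le> norm (A ?w) * norm y" by (rule norm_cauchy_schwarz)
  also have "\<dots> \<le> norm ?w * norm y" by (intro mult_right_mono contractionD(2)[OF A]) simp
  finally show ?thesis by (cases "norm ?w = 0") (auto simp: mult_le_cancel_left)
qed

lemma contraction_cadjoint:
  fixes A :: "'a::chilbert_space \<Rightarrow> 'b::complex_inner"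
  assumes A: "contraction A"
  shows "contraction (cadjoint A)"
  unfolding contraction_def
  using bounded_clinear_cadjoint[OF contractionD(1)[OF A]] norm_cadjoint_le[OF A]
  by (auto intro!: onorm_bound[where b = 1])

lemma kernel_projection:
  fixes A :: "'a::chilbert_space \<Rightarrow> 'b::complex_inner"
  assumes A: "bounded_clinear A"
  obtains Q where "bounded_clinear Q" "\<And>x. A (Q x) = 0" "\<And>x m. A m = 0 \<Longrightarrow> (x - Q x) \<bullet> m = 0"
    "\<And>m. A m = 0 \<Longrightarrow> Q m = m"
proof -
  have "bounded_linear A" and Ac: "\<And>c x. A (c *\<^sub>C x) = c *\<^sub>C A x"
    using A by (simp_all add: bounded_clinear_iff)
  then interpret A: bounded_linear A by blast
  have "subspace {x. A x = 0}" by (auto simp: subspace_def A.add A.scaleR)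
  moreover have "closed {x. A x = 0}"
    by (intro closed_Collect_eq continuous_intros A.continuous_on)
  ultimately have "\<forall>x. \<exists>q. A q = 0 \<and> (\<forall>m. A m = 0 \<longrightarrow> (x - q) \<bullet> m = 0)"
    using closed_subspace_orthogonal_projection[of "{x. A x = 0}"] by blast
  then obtain Q where Q0: "\<And>x. A (Q x) = 0" and Qo: "\<And>x m. A m = 0 \<Longrightarrow> (x - Q x) \<bullet> m = 0"
    by metis
  \<comment> \<open>The difference of two candidates lies in the kernel and is orthogonal to the
    kernel, hence to itself. Every algebraic property of \<open>Q\<close> follows from this
    uniqueness.\<close>
  have uniq: "Q x = q" if "A q = 0" and o: "\<And>m. A m = 0 \<Longrightarrow> (x - q) \<bullet> m = 0" for x q
  proof -
    have k: "A (Q x - q) = 0" using that(1) Q0 by (simp add: A.diff)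
    have "(Q x - q) \<bullet> (Q x - q) = (x - q) \<bullet> (Q x - q) - (x - Q x) \<bullet> (Q x - q)"
      by (simp add: inner_diff_left)
    also have "\<dots> = 0" using o[OF k] Qo[OF k] by simp
    finally show ?thesis by simp
  qed
  have "bounded_linear Q"
  proof (rule bounded_linear_intro[where K = 1])
    fix x y r
    show "Q (x + y) = Q x + Q y"
    proof (rule uniq)
      fix m assume "A m = 0"
      then show "(x + y - (Q x + Q y)) \<bullet> m = 0"
        using Qo[of m x] Qo[of m y] by (simp add: inner_diff_left inner_add_left)
    qed (simp add: A.add Q0)
    show "Q (r *\<^sub>R x) = r *\<^sub>R Q x"
    proof (rule uniq)
      fix m assume "A m = 0"
      then show "(r *\<^sub>R x - r *\<^sub>R Q x) \<bullet> m = 0"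
        using Qo[of m x] by (simp flip: scaleR_diff_right)
    qed (simp add: A.scaleR Q0)
    have "Q x \<bullet> Q x = x \<bullet> Q x" using Qo[OF Q0, of x x] by (simp add: inner_diff_left)
    also have "\<dots> \<le> norm x * norm (Q x)" by (rule norm_cauchy_schwarz)
    finally have "norm (Q x) * norm (Q x) \<le> norm x * norm (Q x)"
      by (simp add: power2_norm_eq_inner flip: power2_eq_square)
    then show "norm (Q x) \<le> norm x * 1"
      by (cases "norm (Q x) = 0") (auto simp: mult_le_cancel_right)
  qed
  moreover have "Q (c *\<^sub>C x) = c *\<^sub>C Q x" for c x
  proof (rule uniq)
    \<comment> \<open>The scalar moves to the other side as its conjugate, and the kernel is a
      complex subspace.\<close>
    fix m assume "A m = 0"
    then have "A (cnj c *\<^sub>C m) = 0" by (simp add: Ac scaleC_zero_right)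
    then have "(x - Q x) \<bullet> (cnj c *\<^sub>C m) = 0" by (rule Qo)
    then show "(c *\<^sub>C x - c *\<^sub>C Q x) \<bullet> m = 0"
      by (simp add: inner_scaleC_left flip: scaleC_diff_right)
  qed (simp add: Ac Q0 scaleC_zero_right)
  ultimately have "bounded_clinear Q" by (simp add: bounded_clinear_iff)
  moreover have "Q m = m" if "A m = 0" for m by (rule uniq) (use that in simp_all)
  ultimately show ?thesis using that Q0 Qo by blast
qed

section \<open>Square roots\<close>

text \<open>The square root of \<open>I - B\<close> is \<open>I - Y\<close> with \<open>Y\<close> a fixed point of
  \<open>Y = (B + Y\<^sup>2) / 2\<close>. The increments of the iteration are dominated in norm by those of the scalar
  iteration with \<open>B = 1\<close>, which is increasing and bounded.\<close>

primrec sqrt_iter :: "('a::real_inner \<Rightarrow> 'a) \<Rightarrow> nat \<Rightarrow> 'a \<Rightarrow> 'a" where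
  "sqrt_iter B 0 = (\<lambda>x. 0)"
| "sqrt_iter B (Suc n) = (\<lambda>x. (1/2) *\<^sub>R (B x + sqrt_iter B n (sqrt_iter B n x)))"

primrec sqrt_iter_bound :: "nat \<Rightarrow> real" where
  "sqrt_iter_bound 0 = 0"
| "sqrt_iter_bound (Suc n) = (1 + sqrt_iter_bound n ^ 2) / 2"

definition sqrt_compl :: "('a::real_inner \<Rightarrow> 'a) \<Rightarrow> 'a \<Rightarrow> 'a"
  where "sqrt_compl B x = lim (\<lambda>n. sqrt_iter B n x)"

lemma sqrt_iter_bound_range: "0 \<le> sqrt_iter_bound n" "sqrt_iter_bound n \<le> 1"
  by (induction n) (auto simp: power_le_one)

lemma incseq_sqrt_iter_bound: "incseq sqrt_iter_bound"
proof (rule incseq_SucI)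
  fix n
  \<comment> \<open>Half of this square is exactly the increment of the scalar iteration.\<close>
  have "0 \<le> (1 - sqrt_iter_bound n)\<^sup>2" by simp
  then show "sqrt_iter_bound n \<le> sqrt_iter_bound (Suc n)"
    by (simp add: power2_eq_square algebra_simps)
qed

lemma convergent_sqrt_iter_bound: "convergent sqrt_iter_bound"
proof -
  have "Bseq sqrt_iter_bound"
    by (rule BseqI'[where K = 1]) (use sqrt_iter_bound_range in simp)
  then show ?thesis using incseq_sqrt_iter_bound by (simp add: Bseq_mono_convergent incseqD)
qed

text \<open>The intended instance is \<open>B\<close> = A^* A for a contraction A, so that I -
  \<open>B\<close> is the square of the defect operator.\<close>

locale selfadjoint_contraction =
  fixes B :: "'a::chilbert_space \<Rightarrow> 'a"
  assumes blin: "bounded_clinear B"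
    and symm: "B x \<bullet> y = x \<bullet> B y"
    and norm_le: "norm (B x) \<le> norm x"
begin

lemma bounded_linear: "bounded_linear B" and scaleC: "B (c *\<^sub>C x) = c *\<^sub>C B x"
  using blin by (simp_all add: bounded_clinear_iff)

lemma iter_bounded_linear: "bounded_linear (sqrt_iter B n)"
proof (induction n)
  case (Suc n)
  then show ?case
    using bounded_linear_const_scaleR[OF bounded_linear_add[OF bounded_linear
          bounded_linear_compose[OF Suc Suc]], of "1/2"] by (simp add: o_def)
qed (simp add: bounded_linear_zero)

lemma iter_scaleC: "sqrt_iter B n (c *\<^sub>C x) = c *\<^sub>C sqrt_iter B n x"
proof (induction n arbitrary: x)
  case (Suc n)
  have "sqrt_iter B (Suc n) (c *\<^sub>C x) = (1/2) *\<^sub>R (c *\<^sub>C (B x + sqrt_iter B n (sqrt_iter B n x)))"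
    by (simp only: sqrt_iter.simps Suc scaleC scaleC_add_right)
  then show ?case by (simp only: sqrt_iter.simps scaleC_scaleR_commute)
qed (simp add: scaleC_zero_right)

lemma iter_symm: "sqrt_iter B n x \<bullet> y = x \<bullet> sqrt_iter B n y"
  by (induction n arbitrary: x y) (simp_all add: symm inner_add_left inner_add_right)

lemma iter_norm: "norm (sqrt_iter B n x) \<le> sqrt_iter_bound n * norm x"
proof (induction n arbitrary: x)
  case (Suc n)
  let ?Y = "sqrt_iter B n" and ?a = "sqrt_iter_bound n"
  have "norm (?Y (?Y x)) \<le> ?a * norm (?Y x)" by (rule Suc)
  also have "\<dots> \<le> ?a * (?a * norm x)" by (intro mult_left_mono Suc sqrt_iter_bound_range)
  finally have "norm (B x + ?Y (?Y x)) \<le> norm x + ?a * (?a * norm x)"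
    using norm_triangle_ineq[of "B x" "?Y (?Y x)"] norm_le[of x] by linarith
  then have "norm ((1/2) *\<^sub>R (B x + ?Y (?Y x))) \<le> (1/2) * (norm x + ?a * (?a * norm x))"
    unfolding norm_scaleR by simp
  also have "\<dots> = sqrt_iter_bound (Suc n) * norm x" by (simp add: power2_eq_square field_simps)
  finally show ?case by (simp only: sqrt_iter.simps)
qed simp

lemma iter_norm_le: "norm (sqrt_iter B n x) \<le> norm x"
proof -
  have "sqrt_iter_bound n * norm x \<le> norm x"
    by (rule mult_left_le_one_le) (simp_all add: sqrt_iter_bound_range)
  with iter_norm[of n x] show ?thesis by linarith
qed

text \<open>For consecutive iterates Y and Z, ZZ - YY = Z(Z - Y) + (Z - Y)Y. With scalar bounds a
  and b this gives the factor (b + a)(b - a) = b^2 - a^2, twice the next scalar increment.\<close>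

lemma iter_Suc_diff:
  "norm (sqrt_iter B (Suc n) x - sqrt_iter B n x) \<le> (sqrt_iter_bound (Suc n) - sqrt_iter_bound n) * norm x"
proof (induction n arbitrary: x)
  case 0
  then show ?case using norm_le[of x] by simp
next
  case (Suc n)
  let ?Y = "sqrt_iter B n" and ?Z = "sqrt_iter B (Suc n)"
  let ?a = "sqrt_iter_bound n" and ?b = "sqrt_iter_bound (Suc n)"
  have ab: "0 \<le> ?b - ?a" using incseqD[OF incseq_sqrt_iter_bound, of n "Suc n"] by simp
  interpret Z: bounded_linear ?Z by (rule iter_bounded_linear)
  have "norm (?Z (?Z x - ?Y x)) \<le> ?b * norm (?Z x - ?Y x)" by (rule iter_norm)
  also have "\<dots> \<le> ?b * ((?b - ?a) * norm x)" by (intro mult_left_mono Suc sqrt_iter_bound_range)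
  finally have 1: "norm (?Z (?Z x - ?Y x)) \<le> ?b * ((?b - ?a) * norm x)" .
  have "norm (?Z (?Y x) - ?Y (?Y x)) \<le> (?b - ?a) * norm (?Y x)" by (rule Suc)
  also have "\<dots> \<le> (?b - ?a) * (?a * norm x)" by (intro mult_left_mono iter_norm ab)
  finally have 2: "norm (?Z (?Y x) - ?Y (?Y x)) \<le> (?b - ?a) * (?a * norm x)" .
  \<comment> \<open>The summand \<open>B x\<close> common to both iterates cancels.\<close>
  have half_diff: "u - v = (1/2) *\<^sub>R (q - r)" if "u = (1/2) *\<^sub>R (p + q)" "v = (1/2) *\<^sub>R (p + r)" for u v p q r :: 'a
    unfolding that by (simp flip: scaleR_diff_right)
  have "sqrt_iter B (Suc (Suc n)) x - ?Z x = (1/2) *\<^sub>R (?Z (?Z x) - ?Y (?Y x))"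
    by (rule half_diff) (rule fun_cong[OF sqrt_iter.simps(2)])+
  also have "?Z (?Z x) - ?Y (?Y x) = ?Z (?Z x - ?Y x) + (?Z (?Y x) - ?Y (?Y x))"
    unfolding Z.diff by (simp del: sqrt_iter.simps)
  also have "norm ((1/2) *\<^sub>R \<dots>) \<le> (1/2) * (?b * ((?b - ?a) * norm x) + (?b - ?a) * (?a * norm x))"
    unfolding norm_scaleR
    by (simp only: abs_of_nonneg zero_le_divide_1_iff zero_le_numeral)
      (intro mult_left_mono norm_triangle_le add_mono 1 2, simp)
  also have "\<dots> = ((1 + ?b^2)/2 - (1 + ?a^2)/2) * norm x"
    by (simp del: sqrt_iter_bound.simps add: power2_eq_square field_simps)
  finally show ?case by simp
qed

lemma iter_diff:
  "m \<le> n \<Longrightarrow> norm (sqrt_iter B n x - sqrt_iter B m x) \<le> (sqrt_iter_bound n - sqrt_iter_bound m) * norm x"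
proof (induction n rule: dec_induct)
  case (step n)
  have "norm (sqrt_iter B (Suc n) x - sqrt_iter B m x)
      \<le> norm (sqrt_iter B (Suc n) x - sqrt_iter B n x) + norm (sqrt_iter B n x - sqrt_iter B m x)"
    using norm_triangle_ineq[of "sqrt_iter B (Suc n) x - sqrt_iter B n x" "sqrt_iter B n x - sqrt_iter B m x"]
    by (simp del: sqrt_iter.simps)
  then show ?case using iter_Suc_diff[of n x] step.IH
    by (simp del: sqrt_iter.simps sqrt_iter_bound.simps add: algebra_simps)
qed simp

lemma iter_tendsto: "(\<lambda>n. sqrt_iter B n x) \<longlonglongrightarrow> sqrt_compl B x"
proof -
  have "Cauchy (\<lambda>n. sqrt_iter_bound n * norm x)"
    using convergent_sqrt_iter_bound by (intro convergent_Cauchy convergent_mult convergent_const)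
  then have "Cauchy (\<lambda>n. sqrt_iter B n x)"
    \<comment> \<open>This form compares only with one fixed index \<open>N\<close> \<le>
      \<open>n\<close>, matching the ordered indices in \<open>iter_diff\<close>.\<close>
    unfolding Cauchy_altdef2
  proof (intro allI impI)
    fix e :: real
    assume C: "\<forall>e>0. \<exists>N. \<forall>n\<ge>N. dist (sqrt_iter_bound n * norm x) (sqrt_iter_bound N * norm x) < e"
      and "0 < e"
    then obtain N where N: "\<And>n. n \<ge> N \<Longrightarrow> dist (sqrt_iter_bound n * norm x) (sqrt_iter_bound N * norm x) < e"
      by blast
    have "dist (sqrt_iter B n x) (sqrt_iter B N x) < e" if "n \<ge> N" for n
      using N[OF that] iter_diff[OF that, of x] by (auto simp: dist_norm left_diff_distrib)
    then show "\<exists>N. \<forall>n\<ge>N. dist (sqrt_iter B n x) (sqrt_iter B N x) < e" by blast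
  qed
  then show ?thesis
    unfolding sqrt_compl_def by (simp add: Cauchy_convergent_iff convergent_LIMSEQ_iff)
qed

lemma sqrt_compl_norm_le: "norm (sqrt_compl B x) \<le> norm x"
  by (rule LIMSEQ_le_const2[OF tendsto_norm[OF iter_tendsto]]) (use iter_norm_le in auto)

lemma sqrt_compl_bounded_clinear: "bounded_clinear (sqrt_compl B)"
proof -
  have "bounded_linear (sqrt_compl B)"
  proof (rule bounded_linear_intro[where K = 1])
    fix x y r
    show "sqrt_compl B (x + y) = sqrt_compl B x + sqrt_compl B y"
      using tendsto_add[OF iter_tendsto iter_tendsto, of x y] iter_tendsto[of "x + y"]
      by (simp add: linear_add[OF bounded_linear.linear[OF iter_bounded_linear]] LIMSEQ_unique)
    show "sqrt_compl B (r *\<^sub>R x) = r *\<^sub>R sqrt_compl B x"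
      using tendsto_scaleR[OF tendsto_const iter_tendsto, of r x] iter_tendsto[of "r *\<^sub>R x"]
      by (simp add: linear_scale[OF bounded_linear.linear[OF iter_bounded_linear]] LIMSEQ_unique)
    show "norm (sqrt_compl B x) \<le> norm x * 1" by (simp add: sqrt_compl_norm_le)
  qed
  moreover have "sqrt_compl B (c *\<^sub>C x) = c *\<^sub>C sqrt_compl B x" for c x
    using bounded_linear.tendsto[OF bounded_linear_scaleC iter_tendsto, of c x] iter_tendsto[of "c *\<^sub>C x"]
    by (simp add: iter_scaleC LIMSEQ_unique)
  ultimately show ?thesis by (simp add: bounded_clinear_iff)
qed

lemma sqrt_compl_symm: "sqrt_compl B x \<bullet> y = x \<bullet> sqrt_compl B y"
  using tendsto_inner[OF iter_tendsto tendsto_const, of x y] tendsto_inner[OF tendsto_const iter_tendsto, of x y]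
  by (simp add: iter_symm LIMSEQ_unique)

lemma sqrt_compl_fixpoint: "sqrt_compl B x = (1/2) *\<^sub>R (B x + sqrt_compl B (sqrt_compl B x))"
proof -
  let ?Y = "sqrt_compl B"
  \<comment> \<open>Convergence is only pointwise, so the product is split: the iterates never
    increase norms, which makes this part vanish, and the rest is the iteration at the fixed vector
    \<open>?Y x\<close>.\<close>
  have "(\<lambda>n. sqrt_iter B n (sqrt_iter B n x - ?Y x)) \<longlonglongrightarrow> 0"
  proof (rule Lim_null_comparison)
    show "(\<lambda>n. norm (sqrt_iter B n x - ?Y x)) \<longlonglongrightarrow> 0"
      using iter_tendsto[of x] by (simp add: LIM_zero tendsto_norm_zero)
  qed (simp add: iter_norm_le)
  from tendsto_add[OF this iter_tendsto[of "?Y x"]]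
  have "(\<lambda>n. sqrt_iter B n (sqrt_iter B n x)) \<longlonglongrightarrow> ?Y (?Y x)"
    by (simp add: linear_diff[OF bounded_linear.linear[OF iter_bounded_linear]])
  then have "(\<lambda>n. (1/2) *\<^sub>R (B x + sqrt_iter B n (sqrt_iter B n x))) \<longlonglongrightarrow> (1/2) *\<^sub>R (B x + ?Y (?Y x))"
    by (intro tendsto_intros)
  then have "(\<lambda>n. sqrt_iter B (Suc n) x) \<longlonglongrightarrow> (1/2) *\<^sub>R (B x + ?Y (?Y x))" by simp
  with LIMSEQ_Suc[OF iter_tendsto[of x]] show ?thesis by (rule LIMSEQ_unique)
qed

end

text \<open>The iterates are polynomials in the operator with real coefficients, so they intertwine
  by induction, and continuity of \<open>Z\<close> carries this to the limit. Allowing two spaces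
  covers embeddings into a direct sum.\<close>

lemma sqrt_compl_intertwine:
  fixes B1 :: "'a::chilbert_space \<Rightarrow> 'a" and B2 :: "'b::chilbert_space \<Rightarrow> 'b"
  assumes B: "selfadjoint_contraction B1" "selfadjoint_contraction B2"
    and Z: "bounded_linear Z" and comm: "\<And>x. B1 (Z x) = Z (B2 x)"
  shows "sqrt_compl B1 (Z x) = Z (sqrt_compl B2 x)"
proof -
  interpret Z: bounded_linear Z by (rule Z)
  have "sqrt_iter B1 n (Z x) = Z (sqrt_iter B2 n x)" for n x
    by (induction n arbitrary: x) (simp_all add: Z.zero Z.add Z.scaleR comm)
  then show ?thesis
    using selfadjoint_contraction.iter_tendsto[OF B(1), of "Z x"]
      Z.tendsto[OF selfadjoint_contraction.iter_tendsto[OF B(2), of x]]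
    by (simp add: LIMSEQ_unique)
qed

text \<open>Over the complex numbers positivity forces symmetry: the quadratic form is real, and
  polarising its vanishing imaginary part gives the symmetry relation.\<close>

lemma positive_op_inner:
  assumes "positive_op S"
  shows "bounded_clinear S" "0 \<le> S x \<bullet> x" "S x \<bullet> y = x \<bullet> S y"
proof -
  show S: "bounded_clinear S" using assms by (simp add: positive_op_def)
  then have Sc: "\<And>c x. S (c *\<^sub>C x) = c *\<^sub>C S x" and "bounded_linear S"
    by (simp_all add: bounded_clinear_iff)
  then interpret S: bounded_linear S by blast
  have re: "cinner (S x) x \<in> \<real>\<^sub>\<ge>\<^sub>0" for x using assms by (simp add: positive_op_def)
  then show "0 \<le> S x \<bullet> x" by (simp add: inner_eq_Re_cinner complex_nonneg_Reals_iff)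
  have im: "(\<i> *\<^sub>C S x) \<bullet> x = 0" for x
    using re[of x] by (simp add: cinner_conv_inner[of "S x"] complex_nonneg_Reals_iff)
  have pol: "(\<i> *\<^sub>C S x) \<bullet> y + (\<i> *\<^sub>C S y) \<bullet> x = 0" for x y
    using im[of "x + y"] im[of x] im[of y]
    by (simp add: S.add scaleC_add_right inner_add_left inner_add_right)
  show "S x \<bullet> y = x \<bullet> S y"
    \<comment> \<open>At i times \<open>x\<close> the two factors i in the first term give a sign,
      and in the second they cancel.\<close>
    using pol[of "\<i> *\<^sub>C x" y] by (simp add: Sc scaleC_ii_ii inner_scaleC_ii inner_commute)
qed

text \<open>The form at y + t S y has no constant term, so its nonnegativity for all real t forces
  the linear coefficient, twice the squared norm of S y, to vanish.\<close>

lemma positive_op_eq_0: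
  assumes S: "positive_op S" and 0: "S y \<bullet> y = 0"
  shows "S y = 0"
proof -
  note P = positive_op_inner[OF S]
  interpret S: bounded_linear S using P(1) by (simp add: bounded_clinear_iff)
  let ?z = "S y"
  let ?a = "?z \<bullet> ?z" and ?b = "S ?z \<bullet> ?z"
  have quad: "0 \<le> 2 * t * ?a + t\<^sup>2 * ?b" for t
  proof -
    have "0 \<le> S (y + t *\<^sub>R ?z) \<bullet> (y + t *\<^sub>R ?z)" by (rule P(2))
    also have "\<dots> = S y \<bullet> y + t * (S y \<bullet> ?z) + t * (S ?z \<bullet> y) + t * t * ?b"
      by (simp add: S.add S.scaleR inner_add_left inner_add_right algebra_simps)
    also have "S ?z \<bullet> y = ?a" by (rule P(3))
    finally show ?thesis using 0 by (simp add: power2_eq_square algebra_simps)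
  qed
  have b: "?b \<ge> 0" by (rule P(2))
  have "?a \<le> 0"
  proof (rule ccontr)
    assume "\<not> ?a \<le> 0"
    then have a: "?a > 0" by linarith
    \<comment> \<open>With t = -\<open>?a * s\<close> the quadratic becomes
      \<open>?a\<^sup>2 * s * (s * ?b - 2)\<close>. The added 1 avoids dividing by
      \<open>?b\<close>, which may be zero, and keeps \<open>s * ?b\<close> below 1.\<close>
    define s where "s = 1 / (?b + 1)"
    have s: "s > 0" and sb: "s * ?b = 1 - s" using b by (simp_all add: s_def field_simps)
    have "2 * (- (?a * s)) * ?a + (- (?a * s))\<^sup>2 * ?b = ?a\<^sup>2 * s * (s * ?b - 2)"
      by (simp add: algebra_simps power2_eq_square)
    also have "\<dots> < 0" unfolding sb
      by (intro mult_pos_neg mult_pos_pos zero_less_power a s) (use s in linarith)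
    finally show False using quad[of "- (?a * s)"] by linarith
  qed
  then show ?thesis by (metis inner_ge_zero inner_eq_zero_iff order_antisym)
qed

context selfadjoint_contraction
begin

lemma positive_op_sqrt: "positive_op (\<lambda>x. x - sqrt_compl B x)"
proof -
  have c: "sqrt_compl B (c *\<^sub>C x) = c *\<^sub>C sqrt_compl B x" for c x
    using sqrt_compl_bounded_clinear by (simp add: bounded_clinear_iff)
  have "cinner (x - sqrt_compl B x) x \<in> \<real>\<^sub>\<ge>\<^sub>0" for x
  proof -
    let ?w = "x - sqrt_compl B x"
    have "sqrt_compl B x \<bullet> x \<le> norm (sqrt_compl B x) * norm x" by (rule norm_cauchy_schwarz)
    also have "\<dots> \<le> norm x * norm x" by (intro mult_right_mono sqrt_compl_norm_le) simp
    finally have "0 \<le> ?w \<bullet> x"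
      by (simp add: inner_diff_left power2_norm_eq_inner flip: power2_eq_square)
    \<comment> \<open>Multiplication by i is skew for the real inner product; with symmetry of the
      root this shows that the imaginary part equals its own negative.\<close>
    have skew: "(\<i> *\<^sub>C u) \<bullet> v = - (u \<bullet> (\<i> *\<^sub>C v))" for u v :: 'a
      using inner_scaleC_ii[of u "\<i> *\<^sub>C v"] by (simp add: scaleC_ii_ii)
    have "(\<i> *\<^sub>C ?w) \<bullet> x = - (?w \<bullet> (\<i> *\<^sub>C x))" by (rule skew)
    also have "\<dots> = - (x \<bullet> (\<i> *\<^sub>C ?w))"
      by (simp add: inner_diff_left inner_diff_right sqrt_compl_symm c scaleC_diff_right)
    finally have "(\<i> *\<^sub>C ?w) \<bullet> x = 0" by (simp add: inner_commute)
    with \<open>0 \<le> ?w \<bullet> x\<close> show ?thesis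
      by (simp add: cinner_conv_inner[of ?w] complex_nonneg_Reals_iff)
  qed
  then show ?thesis
    by (simp add: positive_op_def bounded_clinear_diff[OF bounded_clinear_ident sqrt_compl_bounded_clinear])
qed

text \<open>The fixed-point equation says 2Y = B + Y^2, so (I - Y)^2 = I - 2Y + Y^2 = I - B.\<close>

lemma sqrt_square:
  "(\<lambda>x. x - sqrt_compl B x) \<circ> (\<lambda>x. x - sqrt_compl B x) = (\<lambda>x. x - B x)"
proof
  fix x
  interpret Y: bounded_linear "sqrt_compl B"
    using sqrt_compl_bounded_clinear by (simp add: bounded_clinear_iff)
  have "v + v = w" if "v = (1/2) *\<^sub>R w" for v w :: 'a
    unfolding that by (simp flip: scaleR_add_left)
  from this[OF sqrt_compl_fixpoint]
  have "sqrt_compl B x + sqrt_compl B x = B x + sqrt_compl B (sqrt_compl B x)" .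
  then show "((\<lambda>x. x - sqrt_compl B x) \<circ> (\<lambda>x. x - sqrt_compl B x)) x = x - B x"
    by (simp add: Y.diff algebra_simps)
qed

text \<open>A positive square root \<open>R\<close> of \<open>I - B\<close> commutes with \<open>B\<close>, hence with the root \<open>S\<close> constructed
  above, so that \<open>(S + R) (S - R) = S\<^sup>2 - R\<^sup>2 = 0\<close>.\<close>

lemma sqrt_op_eq: "sqrt_op (\<lambda>x. x - B x) = (\<lambda>x. x - sqrt_compl B x)"
  unfolding sqrt_op_def
proof (rule the_equality)
  let ?S = "\<lambda>x. x - sqrt_compl B x"
  show "positive_op ?S \<and> ?S \<circ> ?S = (\<lambda>x. x - B x)" using positive_op_sqrt sqrt_square by blast
  fix R assume "positive_op R \<and> R \<circ> R = (\<lambda>x. x - B x)"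
  then have pR: "positive_op R" and RR: "\<And>x. R (R x) = x - B x" by (auto simp: fun_eq_iff)
  interpret R: bounded_linear R using positive_op_inner(1)[OF pR] by (simp add: bounded_clinear_iff)
  interpret S: bounded_linear ?S
    using positive_op_inner(1)[OF positive_op_sqrt] by (simp add: bounded_clinear_iff)
  have SS: "?S (?S x) = x - B x" for x using sqrt_square by (simp add: fun_eq_iff)
  have RB: "B (R x) = R (B x)" for x
    using RR[of "R x"] by (simp add: RR R.diff)
  have comm: "?S (R x) = R (?S x)" for x
    using sqrt_compl_intertwine[OF selfadjoint_contraction_axioms selfadjoint_contraction_axioms R.bounded_linear_axioms RB, of x]
    by (simp add: R.diff)
  show "R = ?S"
  proof
    fix x
    define y where "y = ?S x - R x"
    have "?S y + R y = 0"
      using S.diff[of "?S x" "R x"] SS[of x] comm[of x] RR[of x] by (simp add: y_def R.diff)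
    \<comment> \<open>Both terms are nonnegative, so both vanish and \<open>y\<close> is in the
      kernel of both roots; by symmetry \<open>y\<close> is then orthogonal to itself.\<close>
    then have "?S y \<bullet> y + R y \<bullet> y = 0" by (metis inner_add_left inner_zero_left)
    with positive_op_inner(2)[OF positive_op_sqrt, of y] positive_op_inner(2)[OF pR, of y]
    have "?S y \<bullet> y = 0" "R y \<bullet> y = 0" by linarith+
    then have 0: "?S y = 0" "R y = 0"
      using positive_op_eq_0[OF positive_op_sqrt] positive_op_eq_0[OF pR] by blast+
    have "y \<bullet> y = ?S x \<bullet> y - R x \<bullet> y" by (simp add: y_def inner_diff_left)
    also have "\<dots> = x \<bullet> ?S y - x \<bullet> R y"
      using positive_op_inner(3)[OF positive_op_sqrt, of x y] positive_op_inner(3)[OF pR, of x y] by simp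
    also have "\<dots> = 0" using 0 by simp
    finally show "R x = ?S x" by (simp add: y_def)
  qed
qed

end

section \<open>Defect operators\<close>

lemma selfadjoint_contraction_cadjoint:
  fixes A :: "'a::chilbert_space \<Rightarrow> 'b::chilbert_space"
  assumes "contraction A"
  shows "selfadjoint_contraction (\<lambda>x. cadjoint A (A x))"
proof
  note A = contractionD[OF assms]
  show "bounded_clinear (\<lambda>x. cadjoint A (A x))"
    by (rule bounded_clinear_compose[OF bounded_clinear_cadjoint[OF A(1)] A(1)])
  show "cadjoint A (A x) \<bullet> y = x \<bullet> cadjoint A (A y)" for x y
    by (metis inner_cadjoint[OF A(1)] inner_commute)
  show "norm (cadjoint A (A x)) \<le> norm x" for x
    using norm_cadjoint_le[OF assms, of "A x"] A(2)[of x] by linarith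
qed

lemma defect_eq:
  fixes A :: "'a::chilbert_space \<Rightarrow> 'b::chilbert_space"
  assumes "contraction A"
  shows "defect A = (\<lambda>x. x - sqrt_compl (\<lambda>x. cadjoint A (A x)) x)"
  unfolding defect_def
  by (rule selfadjoint_contraction.sqrt_op_eq[OF selfadjoint_contraction_cadjoint[OF assms]])

lemma bounded_clinear_defect:
  fixes A :: "'a::chilbert_space \<Rightarrow> 'b::chilbert_space"
  assumes "contraction A"
  shows "bounded_clinear (defect A)"
  unfolding defect_eq[OF assms]
  by (intro positive_op_inner(1) selfadjoint_contraction.positive_op_sqrt selfadjoint_contraction_cadjoint assms)

lemma defect_intertwine:
  fixes A :: "'a::chilbert_space \<Rightarrow> 'b::chilbert_space" and B :: "'c::chilbert_space \<Rightarrow> 'd::chilbert_space"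
  assumes A: "contraction A" and B: "contraction B" and Z: "bounded_linear Z"
    and comm: "\<And>x. cadjoint A (A (Z x)) = Z (cadjoint B (B x))"
  shows "defect A (Z x) = Z (defect B x)"
proof -
  have "sqrt_compl (\<lambda>x. cadjoint A (A x)) (Z x) = Z (sqrt_compl (\<lambda>x. cadjoint B (B x)) x)"
    by (rule sqrt_compl_intertwine) (simp_all add: selfadjoint_contraction_cadjoint A B Z comm)
  then show ?thesis
    by (simp add: defect_eq[OF A] defect_eq[OF B] linear_diff[OF bounded_linear.linear[OF Z]])
qed

section \<open>Shmul'yan domination of rows\<close>

text \<open>The bound in the definition may be negative, for instance on the zero subspace; chaining
  estimates requires a nonnegative one.\<close>

lemma bounded_clinear_betweenE:
  assumes "bounded_clinear_between H K A"
  obtains M where "M \<ge> 0" "\<And>x. x \<in> H \<Longrightarrow> norm (A x) \<le> M * norm x"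
proof -
  obtain M where M: "\<And>x. x \<in> H \<Longrightarrow> norm (A x) \<le> M * norm x"
    using assms unfolding bounded_clinear_between_def by blast
  have "norm (A x) \<le> \<bar>M\<bar> * norm x" if "x \<in> H" for x
    using M[OF that] mult_right_mono[OF abs_ge_self[of M] norm_ge_zero[of x]] by linarith
  then show ?thesis using that[of "\<bar>M\<bar>"] by simp
qed

lemma bounded_clinear_between_restrict:
  assumes "bounded_clinear A" "A ` H \<subseteq> K"
  shows "bounded_clinear_between H K A"
  using assms by (auto simp: bounded_clinear_between_def)

lemma bounded_clinear_between_compose:
  assumes A: "bounded_clinear_between H K A" and B: "bounded_clinear_between K L B"
  shows "bounded_clinear_between H L (\<lambda>x. B (A x))"
proof -
  obtain M where M: "M \<ge> 0" "\<And>x. x \<in> H \<Longrightarrow> norm (A x) \<le> M * norm x"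
    using A by (rule bounded_clinear_betweenE) blast
  obtain N where N: "N \<ge> 0" "\<And>x. x \<in> K \<Longrightarrow> norm (B x) \<le> N * norm x"
    using B by (rule bounded_clinear_betweenE) blast
  have AK: "\<And>x. x \<in> H \<Longrightarrow> A x \<in> K" using A by (auto simp: bounded_clinear_between_def)
  have "norm (B (A x)) \<le> (N * M) * norm x" if "x \<in> H" for x
    using N(2)[OF AK[OF that]] mult_left_mono[OF M(2)[OF that] N(1)] by (simp add: mult.assoc)
  then show ?thesis using A B AK unfolding bounded_clinear_between_def by auto
qed

text \<open>The domain \<open>S\<close> is a subset of the product because it will be the defect
  space of a row, for which an inclusion is established.\<close>

lemma bounded_clinear_between_row:
  assumes A: "bounded_clinear_between H K A" and B: "bounded_clinear_between H' K B"
    and K: "\<And>x y. x \<in> K \<Longrightarrow> y \<in> K \<Longrightarrow> x + y \<in> K" and S: "S \<subseteq> H \<times> H'"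
  shows "bounded_clinear_between S K (\<lambda>p. A (fst p) + B (snd p))"
proof -
  obtain M where M: "M \<ge> 0" "\<And>x. x \<in> H \<Longrightarrow> norm (A x) \<le> M * norm x"
    using A by (rule bounded_clinear_betweenE) blast
  obtain N where N: "N \<ge> 0" "\<And>x. x \<in> H' \<Longrightarrow> norm (B x) \<le> N * norm x"
    using B by (rule bounded_clinear_betweenE) blast
  have mem: "fst p \<in> H" "snd p \<in> H'" if "p \<in> S" for p using that S by auto
  have "norm (A (fst p) + B (snd p)) \<le> (M + N) * norm p" if "p \<in> S" for p
  proof -
    have "norm (A (fst p)) \<le> M * norm p"
      using M(2)[OF mem(1)[OF that]] mult_left_mono[OF norm_fst_le[of "fst p" "snd p"] M(1)] by simp
    moreover have "norm (B (snd p)) \<le> N * norm p"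
      using N(2)[OF mem(2)[OF that]] mult_left_mono[OF norm_snd_le[of "snd p" "fst p"] N(1)] by simp
    ultimately show ?thesis by (simp add: norm_triangle_le distrib_right)
  qed
  moreover have "(\<lambda>p. A (fst p) + B (snd p)) ` S \<subseteq> K"
  proof (rule image_subsetI)
    fix p assume "p \<in> S"
    from mem[OF this] A B show "A (fst p) + B (snd p) \<in> K"
      by (intro K) (auto simp: bounded_clinear_between_def)
  qed
  moreover have "A (fst (p + q)) + B (snd (p + q)) = (A (fst p) + B (snd p)) + (A (fst q) + B (snd q))"
    if "p \<in> S" "q \<in> S" for p q
    using A B mem[OF that(1)] mem[OF that(2)] by (simp add: bounded_clinear_between_def)
  moreover have "A (fst (c *\<^sub>C p)) + B (snd (c *\<^sub>C p)) = c *\<^sub>C (A (fst p) + B (snd p))" if "p \<in> S" for p c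
    using A B mem[OF that] by (simp add: bounded_clinear_between_def scaleC_prod_def scaleC_add_right)
  ultimately show ?thesis unfolding bounded_clinear_between_def by blast
qed

lemma closure_add_closed:
  fixes S :: "'a::real_normed_vector set"
  assumes "\<And>x y. x \<in> S \<Longrightarrow> y \<in> S \<Longrightarrow> x + y \<in> S"
    and "x \<in> closure S" "y \<in> closure S"
  shows "x + y \<in> closure S"
proof -
  obtain f g where "\<And>n. f n \<in> S" "f \<longlonglongrightarrow> x" "\<And>n. g n \<in> S" "g \<longlonglongrightarrow> y"
    using assms(2,3) unfolding closure_sequential by blast
  then show ?thesis
    unfolding closure_sequential using assms(1)
    by (intro exI[of _ "\<lambda>n. f n + g n"]) (auto intro: tendsto_add)
qed

section \<open>Rows of operators with orthogonal ranges\<close>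

lemma cadjoint_row:
  fixes A :: "'a::chilbert_space \<Rightarrow> 'h::chilbert_space" and B :: "'b::chilbert_space \<Rightarrow> 'h"
  assumes A: "bounded_clinear A" and B: "bounded_clinear B"
  shows "cadjoint (\<lambda>p. A (fst p) + B (snd p)) = (\<lambda>z. (cadjoint A z, cadjoint B z))"
proof (rule cadjoint_eqI_real)
  show "bounded_clinear (\<lambda>p. A (fst p) + B (snd p))"
    by (rule bounded_clinear_between_row[OF A B]) auto
  show "(A (fst p) + B (snd p)) \<bullet> y = p \<bullet> (cadjoint A y, cadjoint B y)" for p y
    by (simp add: inner_add_left inner_prod_def inner_cadjoint[OF A] inner_cadjoint[OF B])
qed

text \<open>B^* A is the adjoint of A^* B.\<close>

lemma cadjoint_comp_eq_0_commute:
  fixes A :: "'a::chilbert_space \<Rightarrow> 'h::chilbert_space" and B :: "'b::chilbert_space \<Rightarrow> 'h"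
  assumes A: "bounded_clinear A" and B: "bounded_clinear B" and "\<And>x. cadjoint A (B x) = 0"
  shows "cadjoint B (A x) = 0"
proof -
  have "y \<bullet> cadjoint B (A x) = 0" for y
  proof -
    have "y \<bullet> cadjoint B (A x) = x \<bullet> cadjoint A (B y)"
      by (metis inner_cadjoint[OF A] inner_cadjoint[OF B] inner_commute)
    then show ?thesis using assms(3) by simp
  qed
  then show ?thesis by (metis inner_eq_zero_iff)
qed

text \<open>The range of \<open>A\<close> lies in the kernel of \<open>B\<^sup>*\<close>, so the projection \<open>Q\<close> onto that kernel commutes
  with \<open>A A\<^sup>*\<close> and annihilates the difference of \<open>R R\<^sup>*\<close> and \<open>A A\<^sup>*\<close>.\<close>

lemma defect_cadjoint_row:
  fixes A :: "'a::chilbert_space \<Rightarrow> 'h::chilbert_space" and B :: "'b::chilbert_space \<Rightarrow> 'h"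
    and R :: "'c::chilbert_space \<Rightarrow> 'h"
  assumes A: "contraction A" and B: "bounded_clinear B" and R: "contraction R"
    and RR: "\<And>z. R (cadjoint R z) = A (cadjoint A z) + B (cadjoint B z)"
    and orth: "\<And>x. cadjoint B (A x) = 0"
  obtains Q where "bounded_clinear_between (defect_space (cadjoint A)) (defect_space (cadjoint R)) Q"
    "\<And>m. cadjoint B m = 0 \<Longrightarrow> Q m = m"
    "\<And>x. defect (cadjoint R) (Q x) = Q (defect (cadjoint A) x)"
proof -
  note Al = contractionD(1)[OF A] and Rl = contractionD(1)[OF R]
  obtain Q where Q: "bounded_clinear Q" "\<And>x. cadjoint B (Q x) = 0"
    "\<And>x m. cadjoint B m = 0 \<Longrightarrow> (x - Q x) \<bullet> m = 0" "\<And>m. cadjoint B m = 0 \<Longrightarrow> Q m = m"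
    using kernel_projection[OF bounded_clinear_cadjoint[OF B]] by blast
  \<comment> \<open>\<open>x - Q x\<close> is orthogonal to the kernel of B^*, which contains the
    range of \<open>A\<close>.\<close>
  have AQ: "cadjoint A (Q x) = cadjoint A x" for x
  proof -
    have "y \<bullet> cadjoint A (Q x) = y \<bullet> cadjoint A x" for y
      using Q(3)[OF orth, of x y] by (simp add: inner_cadjoint[OF Al, symmetric] inner_diff_right inner_commute[of _ "A y"])
    then show ?thesis by (metis vector_eq_ldot)
  qed
  have B0: "B 0 = 0"
    using B by (simp add: bounded_clinear_iff linear_0 bounded_linear.linear)
  \<comment> \<open>Here R R^* Q = A A^* Q + B B^* Q = A A^*, and this equals Q A A^* because
    \<open>Q\<close> fixes the range of \<open>A\<close>.\<close>
  have inter: "defect (cadjoint R) (Q x) = Q (defect (cadjoint A) x)" for x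
    by (rule defect_intertwine)
      (use A R Q orth B0 in \<open>simp_all add: contraction_cadjoint bounded_clinear_iff cadjoint_cadjoint[OF Al]
        cadjoint_cadjoint[OF Rl] RR AQ\<close>)
  \<comment> \<open>By \<open>inter\<close>, \<open>Q\<close> maps range into range; continuity
    extends this to the closures, that is, to the defect spaces.\<close>
  have "continuous_on UNIV Q"
    using Q(1) by (simp add: bounded_clinear_iff linear_continuous_on)
  then have "Q ` closure (range (defect (cadjoint A))) \<subseteq> closure (range (defect (cadjoint R)))"
  proof (rule image_closure_subset[OF continuous_on_subset])
    show "Q ` range (defect (cadjoint A)) \<subseteq> closure (range (defect (cadjoint R)))"
      using closure_subset[of "range (defect (cadjoint R))"] by (auto simp flip: inter)
  qed auto
  then have "bounded_clinear_between (defect_space (cadjoint A)) (defect_space (cadjoint R)) Q"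
    unfolding defect_space_def by (rule bounded_clinear_between_restrict[OF Q(1)])
  then show ?thesis using that Q(4) inter by blast
qed

text \<open>The off-diagonal entries A^* B and B^* A of R^* R vanish, so each coordinate embedding
  intertwines the defect operator of one entry with that of the row; linearity adds the two.\<close>

lemma defect_row:
  fixes A :: "'a::chilbert_space \<Rightarrow> 'h::chilbert_space" and B :: "'b::chilbert_space \<Rightarrow> 'h"
  assumes A: "contraction A" and B: "contraction B" and R: "contraction (\<lambda>p. A (fst p) + B (snd p))"
    and orth: "\<And>x. cadjoint A (B x) = 0"
  shows "defect (\<lambda>p. A (fst p) + B (snd p)) p = (defect A (fst p), defect B (snd p))"
proof -
  let ?R = "\<lambda>p. A (fst p) + B (snd p)"
  note Al = contractionD(1)[OF A] and Bl = contractionD(1)[OF B]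
  note orth' = cadjoint_comp_eq_0_commute[OF Al Bl orth]
  have 0: "A 0 = 0" "B 0 = 0"
    using Al Bl by (simp_all add: bounded_clinear_iff linear_0 bounded_linear.linear)
  have l: "defect ?R (x, 0) = (defect A x, 0)" for x
    by (rule defect_intertwine[OF R A, where Z = "\<lambda>x. (x, 0)"])
      (simp_all add: cadjoint_row[OF Al Bl] 0 orth' bounded_linear_Pair bounded_linear_ident bounded_linear_zero)
  have r: "defect ?R (0, y) = (0, defect B y)" for y
    by (rule defect_intertwine[OF R B, where Z = "\<lambda>y. (0, y)"])
      (simp_all add: cadjoint_row[OF Al Bl] 0 orth bounded_linear_Pair bounded_linear_ident bounded_linear_zero)
  have "linear (defect ?R)"
    using bounded_clinear_defect[OF R] by (simp add: bounded_clinear_iff bounded_linear.linear)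
  from linear_add[OF this, of "(fst p, 0)" "(0, snd p)"] show ?thesis by (simp add: l r)
qed

lemma shmulyan_dominates_row:
  fixes A A' :: "'a::chilbert_space \<Rightarrow> 'h::chilbert_space" and B B' :: "'b::chilbert_space \<Rightarrow> 'h"
  assumes domA: "shmulyan_dominates A A'" and domB: "shmulyan_dominates B B'"
    and R: "contraction (\<lambda>p. A (fst p) + B (snd p))"
    and R': "contraction (\<lambda>p. A' (fst p) + B' (snd p))"
    and orth: "\<And>x. cadjoint A (B x) = 0"
    and AB': "\<And>x. cadjoint A (B' x) = 0" and BA': "\<And>x. cadjoint B (A' x) = 0"
  shows "shmulyan_dominates (\<lambda>p. A (fst p) + B (snd p)) (\<lambda>p. A' (fst p) + B' (snd p))"
proof -
  let ?R = "\<lambda>p. A (fst p) + B (snd p)"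
  have A: "contraction A" and B: "contraction B"
    using domA domB by (simp_all add: shmulyan_dominates_def)
  note Al = contractionD(1)[OF A] and Bl = contractionD(1)[OF B]
  note orth' = cadjoint_comp_eq_0_commute[OF Al Bl orth]
  obtain X where X: "bounded_clinear_between (defect_space A) (defect_space (cadjoint A)) X"
    and A': "\<And>x. A' x = A x + defect (cadjoint A) (X (defect A x))"
    using domA unfolding shmulyan_dominates_def by blast
  obtain Y where Y: "bounded_clinear_between (defect_space B) (defect_space (cadjoint B)) Y"
    and B': "\<And>x. B' x = B x + defect (cadjoint B) (Y (defect B x))"
    using domB unfolding shmulyan_dominates_def by blast
  have RR: "?R (cadjoint ?R z) = A (cadjoint A z) + B (cadjoint B z)" for z
    by (simp add: cadjoint_row[OF Al Bl])
  obtain P where P: "bounded_clinear_between (defect_space (cadjoint A)) (defect_space (cadjoint ?R)) P"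
    and Pfix: "\<And>m. cadjoint B m = 0 \<Longrightarrow> P m = m"
    and Pint: "\<And>x. defect (cadjoint ?R) (P x) = P (defect (cadjoint A) x)"
    using defect_cadjoint_row[OF A Bl R RR orth'] by blast
  obtain Q where Q: "bounded_clinear_between (defect_space (cadjoint B)) (defect_space (cadjoint ?R)) Q"
    and Qfix: "\<And>m. cadjoint A m = 0 \<Longrightarrow> Q m = m"
    and Qint: "\<And>x. defect (cadjoint ?R) (Q x) = Q (defect (cadjoint B) x)"
    \<comment> \<open>The same construction with the roles of \<open>A\<close> and \<open>B\<close>
      exchanged, hence the reordered sum in \<open>RR\<close>.\<close>
    using defect_cadjoint_row[OF B Al R, of thesis] RR orth by (simp add: add.commute)
  have diff_adj: "cadjoint C (u - v) = cadjoint C u - cadjoint C v"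
    if "bounded_clinear C" for C :: "'x::chilbert_space \<Rightarrow> 'h" and u v
    using bounded_clinear_cadjoint[OF that]
    by (simp add: bounded_clinear_iff linear_diff bounded_linear.linear)
  \<comment> \<open>B^* annihilates the ranges of both \<open>A'\<close> and \<open>A\<close>, so
    \<open>P\<close> fixes their difference.\<close>
  have PX: "P (defect (cadjoint A) (X (defect A x))) = A' x - A x" for x
  proof -
    have "P (A' x - A x) = A' x - A x" by (rule Pfix) (simp add: diff_adj[OF Bl] BA' orth')
    then show ?thesis by (simp add: A')
  qed
  have QY: "Q (defect (cadjoint B) (Y (defect B x))) = B' x - B x" for x
  proof -
    have "Q (B' x - B x) = B' x - B x" by (rule Qfix) (simp add: diff_adj[OF Al] AB' orth)
    then show ?thesis by (simp add: B')
  qed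
  have lin: "linear (defect (cadjoint ?R))"
    using bounded_clinear_defect[OF contraction_cadjoint[OF R]]
    by (simp add: bounded_clinear_iff bounded_linear.linear)
  have "x + y \<in> range (defect (cadjoint ?R))"
    if "x \<in> range (defect (cadjoint ?R))" "y \<in> range (defect (cadjoint ?R))" for x y
    using that by (auto simp flip: linear_add[OF lin])
  note add = closure_add_closed[OF this, folded defect_space_def]
  have "range (defect ?R) \<subseteq> defect_space A \<times> defect_space B"
    using closure_subset[of "range (defect A)"] closure_subset[of "range (defect B)"]
    by (auto simp: defect_row[OF A B R orth] defect_space_def)
  then have dom: "defect_space ?R \<subseteq> defect_space A \<times> defect_space B"
    unfolding defect_space_def[of ?R] by (rule closure_minimal) (simp add: defect_space_def closed_Times)
  have "bounded_clinear_between (defect_space ?R) (defect_space (cadjoint ?R))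
      (\<lambda>p. P (X (fst p)) + Q (Y (snd p)))"
    by (rule bounded_clinear_between_row[OF bounded_clinear_between_compose[OF X P]
          bounded_clinear_between_compose[OF Y Q] add dom])
  \<comment> \<open>The defect operator of the adjoint row moves past \<open>P\<close> and
    \<open>Q\<close>, leaving \<open>P\<close> and \<open>Q\<close> applied to the correction terms
    of the columns, which they fix.\<close>
  moreover have "A' (fst p) + B' (snd p) = ?R p
      + defect (cadjoint ?R) (P (X (fst (defect ?R p))) + Q (Y (snd (defect ?R p))))" for p
    by (simp add: linear_add[OF lin] Pint Qint PX QY defect_row[OF A B R orth])
  ultimately show ?thesis unfolding shmulyan_dominates_def using R R' by blast
qed

text \<open>This turns the blockwise hypotheses into vanishing products of an adjoint column with a
  column.\<close>

lemma cadjoint_column_op: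
  fixes A :: "'a::chilbert_space \<Rightarrow> 'c::chilbert_space" and B :: "'a \<Rightarrow> 'd::chilbert_space"
  assumes A: "bounded_clinear A" and B: "bounded_clinear B"
  shows "cadjoint (column_op A B) z = cadjoint A (fst z) + cadjoint B (snd z)"
proof -
  have "bounded_clinear (column_op A B)"
    using A B by (simp add: column_op_def bounded_clinear_iff bounded_linear_Pair scaleC_prod_def)
  then have "cadjoint (column_op A B) = (\<lambda>z. cadjoint A (fst z) + cadjoint B (snd z))"
    by (rule cadjoint_eqI_real)
      (simp add: column_op_def inner_prod_def inner_add_right inner_cadjoint[OF A] inner_cadjoint[OF B])
  then show ?thesis by simp
qed

lemma block_op_eq_row:
  "block_op T0 T1 T2 T3 = (\<lambda>p. column_op T0 T2 (fst p) + column_op T1 T3 (snd p))"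
  by (auto simp: block_op_def column_op_def)

theorem proposition3p5:
  fixes T0 T0' :: "'e0::chilbert_space \<Rightarrow> 'f0::chilbert_space"
    and T1 T1' :: "'e1::chilbert_space \<Rightarrow> 'f0"
    and T2 T2' :: "'e0 \<Rightarrow> 'f1::chilbert_space"
    and T3 T3' :: "'e1 \<Rightarrow> 'f1"
    and T T' :: "'e0 \<times> 'e1 \<Rightarrow> 'f0 \<times> 'f1"
    and C0 C0' :: "'e0 \<Rightarrow> 'f0 \<times> 'f1"
    and C1 C1' :: "'e1 \<Rightarrow> 'f0 \<times> 'f1"
  assumes blocks: "bounded_clinear T0" "bounded_clinear T1" "bounded_clinear T2" "bounded_clinear T3"
    and blocks': "bounded_clinear T0'" "bounded_clinear T1'" "bounded_clinear T2'" "bounded_clinear T3'"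
    and T: "T = block_op T0 T1 T2 T3" "contraction T"
    and T': "T' = block_op T0' T1' T2' T3'" "contraction T'"
    and orth: "\<forall>x. cadjoint T0 (T1 x) + cadjoint T2 (T3 x) = 0"
    and orth': "\<forall>x. cadjoint T0' (T1' x) + cadjoint T2' (T3' x) = 0"
    and cross0: "\<forall>x. cadjoint T0 (T1' x) + cadjoint T2 (T3' x) = 0"
    and cross1: "\<forall>x. cadjoint T1 (T0' x) + cadjoint T3 (T2' x) = 0"
    and C0: "C0 = column_op T0 T2" and C0': "C0' = column_op T0' T2'"
    and C1: "C1 = column_op T1 T3" and C1': "C1' = column_op T1' T3'"
    and equiv0: "shmulyan_equivalent C0 C0'"
    and equiv1: "shmulyan_equivalent C1 C1'"
  shows "shmulyan_equivalent T T'"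
proof -
  have dom: "shmulyan_dominates C0 C0'" "shmulyan_dominates C0' C0"
    "shmulyan_dominates C1 C1'" "shmulyan_dominates C1' C1"
    using equiv0 equiv1 by (simp_all add: shmulyan_equivalent_def)
  then have lin: "bounded_clinear C0" "bounded_clinear C0'" "bounded_clinear C1" "bounded_clinear C1'"
    by (simp_all add: shmulyan_dominates_def contraction_def)
  have row: "T = (\<lambda>p. C0 (fst p) + C1 (snd p))" "T' = (\<lambda>p. C0' (fst p) + C1' (snd p))"
    unfolding T(1) T'(1) C0 C1 C0' C1' block_op_eq_row by (rule refl)+
  have "cadjoint C0 (C1 x) = 0" "cadjoint C0' (C1' x) = 0" "cadjoint C0 (C1' x) = 0" for x
    unfolding C0 C0' cadjoint_column_op[OF blocks(1,3)] cadjoint_column_op[OF blocks'(1,3)]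
    using orth orth' cross0 by (simp_all add: C1 C1' column_op_def)
  moreover have "cadjoint C1 (C0' x) = 0" for x
    unfolding C1 cadjoint_column_op[OF blocks(2,4)] using cross1 by (simp add: C0' column_op_def)
  \<comment> \<open>Domination of \<open>T\<close> by \<open>T'\<close> needs the cross conditions
    with the primed columns under the adjoint; they are the adjoints of the given ones.\<close>
  moreover from calculation have "cadjoint C1' (C0 x) = 0" "cadjoint C0' (C1 y) = 0" for x y
    using cadjoint_comp_eq_0_commute[OF lin(1,4)] cadjoint_comp_eq_0_commute[OF lin(3,2)] by blast+
  ultimately show ?thesis
    unfolding shmulyan_equivalent_def row
    using dom T(2) T'(2) unfolding row by (intro conjI shmulyan_dominates_row)
qed

end
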